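(* Let $m\in\mathbb{Z}_{\geq 0}$. The polynomial $(q;q)_m=\prod_{i=1}^{m}(1-q^i)$ is of Bloch--Pólya type if and only if $m\in\{0,1,2,3,5\}$.
   Context: A polynomial (or power series) in $q$ is said to be of Bloch--Pólya type if all of its coefficients belong to the set $\{-1,0,1\}$. For a non-negative integer $m$, $(q;q)_m=\prod_{i=1}^{m}(1-q^i)$, with $(q;q)_0=1$. *)

theory Defs
  imports "HOL-Computational_Algebra.Polynomial"
begin

definition bloch_polya :: "int poly \<Rightarrow> bool"
  where "bloch_polya p \<longleftrightarrow> (\<forall>n. coeff p n \<in> {-1, 0, 1})"

text \<open>The finite \<open>q\<close>-factorial \<open>(q;q)\<^sub>m\<close> as a polynomial in the indeterminate \<open>q\<close>.\<close>
definition qq :: "nat \<Rightarrow> int poly"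
  where "qq m = (\<Prod>i=1..m. (1 - monom 1 i))"

end

theory Submission
  imports Defs "HOL-Analysis.Complex_Transcendental"
begin

text \<open>
  If all coefficients of \<open>(q;q)\<^sub>m\<close> are bounded by 1, then its modulus on the unit circle is at
  most \<open>m (m + 1) / 2 + 1\<close>. At a primitive \<open>N\<close>-th root of unity \<open>\<zeta>\<close> with \<open>N = m + 4\<close>, however, the
  full product of \<open>1 - \<zeta>\<^sup>k\<close> over \<open>0 < k < N\<close> equals \<open>N\<close>, and the three factors missing from
  \<open>(\<zeta>;\<zeta>)\<^sub>m\<close> have moduli at most \<open>2\<pi>/N\<close>, \<open>4\<pi>/N\<close> and \<open>6\<pi>/N\<close>. So the modulus there is at least
  \<open>N\<^sup>4 / (6 (2\<pi>)\<^sup>3)\<close>, which is too large as soon as \<open>m \<ge> 20\<close>. The remaining cases are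
  computations.
\<close>

lemma qq_0: "qq 0 = 1"
  by (simp add: qq_def)

lemma qq_Suc: "qq (Suc m) = qq m * (1 - monom 1 (Suc m))"
  by (simp add: qq_def prod.nat_ivl_Suc')

lemma coeff_mult_one_minus_monom:
  fixes p :: "'a::comm_ring_1 poly"
  shows "coeff (p * (1 - monom 1 k)) n = coeff p n - (if k \<le> n then coeff p (n - k) else 0)"
  by (simp add: right_diff_distrib coeff_monom_mult mult.commute[of p "monom 1 k"])

text \<open>The coefficients of \<open>(q;q)\<^sub>m\<close> up to degree \<open>L\<close>; \<open>map2\<close> truncates to the shorter list.\<close>

fun qq_row :: "nat \<Rightarrow> nat \<Rightarrow> int list"
  where
    "qq_row L 0 = 1 # replicate L 0"
  | "qq_row L (Suc m) =
      (let r = qq_row L m in map2 (-) r (replicate (Suc m) 0 @ r))"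

lemma length_qq_row [simp]: "length (qq_row L m) = Suc L"
  by (induction m) (auto simp: Let_def)

lemma nth_qq_row: "n \<le> L \<Longrightarrow> qq_row L m ! n = coeff (qq m) n"
proof (induction m arbitrary: n)
  case 0
  then show ?case by (cases n) (auto simp: qq_0)
next
  case (Suc m)
  \<comment> \<open>The \<open>Suc m\<close> prepended zeros supply the value 0 of the shifted
    coefficient at every index \<open>n\<close> below \<open>Suc m\<close>.\<close>
  then show ?case
    by (simp add: Let_def qq_Suc coeff_mult_one_minus_monom nth_append del: replicate_Suc)
qed

lemma degree_qq_le: "degree (qq m) \<le> m * (m + 1) div 2"
proof (induction m)
  case 0
  then show ?case by (simp add: qq_0)
next
  case (Suc m)
  have "degree (1 - monom 1 (Suc m) :: int poly) \<le> Suc m"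
    by (intro degree_diff_le) (auto simp: degree_monom_le)
  then show ?case
    using Suc degree_mult_le[of "qq m" "1 - monom 1 (Suc m)"] by (simp add: qq_Suc)
qed

lemma bloch_polya_qq_small:
  assumes "m \<in> {0, 1, 2, 3, 5}"
  shows "bloch_polya (qq m)"
  unfolding bloch_polya_def
proof
  fix n
  \<comment> \<open>Since 15 = 5 * 6 / 2 bounds the degree for each of these \<open>m\<close>, the
    truncated row misses no nonzero coefficient.\<close>
  have row: "\<forall>m\<in>set [0, 1, 2, 3, 5]. \<forall>c\<in>set (qq_row 15 m). c \<in> set [-1, 0, 1]"
    by code_simp
  show "coeff (qq m) n \<in> {-1, 0, 1}"
  proof (cases "n \<le> 15")
    case True
    then have "coeff (qq m) n \<in> set (qq_row 15 m)"
      by (metis length_qq_row less_Suc_eq_le nth_mem nth_qq_row)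
    moreover have "m \<in> set [0, 1, 2, 3, 5]"
      using assms by simp
    ultimately show ?thesis
      using row by (metis empty_set list.simps(15))
  next
    case False
    then have "degree (qq m) < n"
      using degree_qq_le[of m] assms by auto
    then show ?thesis by (simp add: coeff_eq_0)
  qed
qed

lemma not_bloch_polya_qq_small:
  assumes "m = 4 \<or> 6 \<le> m \<and> m < 20"
  shows "\<not> bloch_polya (qq m)"
proof -
  \<comment> \<open>Truncation is harmless: entries up to degree 35 are exact, and for each of these
    \<open>m\<close> a coefficient of modulus at least 2 occurs that early.\<close>
  have "\<forall>m\<in>set (4 # [6..<20]). \<exists>c\<in>set (qq_row 35 m). c \<notin> set [-1, 0, 1]"
    by code_simp
  moreover have "m \<in> set (4 # [6..<20])"
    using assms by (simp only: list.set set_upt) auto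
  ultimately obtain c where "c \<in> set (qq_row 35 m)" "c \<notin> {-1, 0, 1}"
    by (metis empty_set list.simps(15))
  then obtain n where "n < length (qq_row 35 m)" "qq_row 35 m ! n \<notin> {-1, 0, 1}"
    by (metis in_set_conv_nth)
  then have "coeff (qq m) n \<notin> {-1, 0, 1}"
    by (simp add: nth_qq_row)
  then show ?thesis
    unfolding bloch_polya_def by blast
qed

text \<open>Allows the integer polynomial to be evaluated at complex points.\<close>

lemma map_poly_of_int_qq:
  "map_poly of_int (qq m) = (\<Prod>i=1..m. 1 - monom (1::'a::comm_ring_1) i)"
proof (induction m)
  case 0
  then show ?case by (simp add: qq_0)
next
  case (Suc m)
  have "map_poly of_int (qq (Suc m)) = map_poly of_int (qq m) * (1 - monom (1::'a) (Suc m))"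
    by (rule poly_eqI) (simp add: coeff_map_poly qq_Suc coeff_mult_one_minus_monom)
  with Suc show ?case by (simp add: prod.nat_ivl_Suc')
qed

lemma norm_poly_le_Suc_degree:
  fixes p :: "'a::real_normed_field poly"
  assumes "\<And>n. norm (coeff p n) \<le> 1" "norm z \<le> 1" "degree p \<le> d"
  shows "norm (poly p z) \<le> real d + 1"
proof -
  have "norm (poly p z) \<le> (\<Sum>i\<le>degree p. norm (coeff p i * z ^ i))"
    unfolding poly_altdef by (rule norm_sum)
  also have "\<dots> \<le> (\<Sum>i\<le>degree p. 1)"
    using assms by (intro sum_mono) (auto simp: norm_mult norm_power intro!: mult_le_one power_le_one)
  also have "\<dots> \<le> real d + 1"
    using assms by simp
  finally show ?thesis .
qed

lemma norm_prod_le_if_bloch_polya: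
  fixes z :: complex
  assumes "bloch_polya (qq m)" "norm z \<le> 1"
  shows "norm (\<Prod>i=1..m. 1 - z ^ i) \<le> real (m * (m + 1) div 2) + 1"
proof -
  let ?p = "map_poly of_int (qq m) :: complex poly"
  have "norm (coeff ?p n) \<le> 1" for n
  proof -
    have "coeff (qq m) n \<in> {-1, 0, 1}"
      using assms(1) unfolding bloch_polya_def by blast
    then show ?thesis by (auto simp: coeff_map_poly)
  qed
  moreover have "degree ?p \<le> m * (m + 1) div 2"
    using degree_qq_le[of m] by (intro degree_le) (auto simp: coeff_map_poly coeff_eq_0)
  ultimately have "norm (poly ?p z) \<le> real (m * (m + 1) div 2) + 1"
    using assms(2) by (intro norm_poly_le_Suc_degree)
  then show ?thesis
    by (simp add: map_poly_of_int_qq poly_prod poly_monom)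
qed

text \<open>The monic polynomial \<open>P\<close> whose roots are the nontrivial \<open>N\<close>-th
  roots of unity is the geometric sum \<open>Q\<close>; both are then evaluated at 1.\<close>

lemma prod_one_minus_roots_of_unity:
  fixes N :: nat
  assumes "N > 0"
  shows "(\<Prod>k=1..<N. 1 - cis (2 * pi * real k / real N)) = of_nat N"
proof -
  define w where "w k = cis (2 * pi * real k / real N)" for k
  define P where "P = (\<Prod>k=1..<N. [:- w k, 1:])"
  define Q where "Q = (\<Sum>k<N. monom (1::complex) k)"
  have bij: "bij_betw w {..<N} {z. z ^ N = 1}"
    using Complex.bij_betw_roots_unity[OF assms] by (simp add: w_def[abs_def])
  then have inj: "inj_on w {..<N}"
    by (rule bij_betw_imp_inj_on)
  have w0: "w 0 = 1"
    by (simp add: w_def)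
  have degP: "degree P = N - 1"
    unfolding P_def by (subst degree_prod_sum_eq) auto
  have leadP: "lead_coeff P = 1"
    by (simp add: P_def lead_coeff_prod)
  have coeffQ: "coeff Q n = (if n < N then 1 else 0)" for n
    by (simp add: Q_def coeff_sum)
  have degQ: "degree Q \<le> N - 1"
    using assms by (intro degree_le) (auto simp: coeffQ)
  have "P = Q"
  \<comment> \<open>Agreement of the coefficients at degree \<open>N - 1\<close> saves one point, so
    the \<open>N - 1\<close> common zeros suffice.\<close>
  proof (rule poly_eqI_degree_lead_coeff[of P "N - 1" Q "w ` {1..<N}"])
    have "inj_on w {1..<N}"
      using inj by (rule inj_on_subset) auto
    then show "N - 1 \<le> card (w ` {1..<N})"
      by (simp add: card_image)
    fix z assume "z \<in> w ` {1..<N}"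
    then obtain k where k: "k \<in> {1..<N}" "z = w k" by blast
    then have "poly P z = 0"
      by (auto simp: P_def poly_prod)
    moreover have "z \<noteq> 1"
      using inj k w0 assms by (metis atLeastLessThan_iff inj_on_eq_iff lessThan_iff not_one_le_zero)
    moreover have "z ^ N = 1"
      using bij k by (auto simp: bij_betw_def)
    ultimately show "poly P z = poly Q z"
      by (simp add: Q_def poly_sum poly_monom sum_gp_strict)
  qed (use degP degQ leadP assms in \<open>auto simp: coeffQ\<close>)
  then have "poly P 1 = poly Q 1" by simp
  then show ?thesis
    by (simp add: P_def Q_def w_def poly_prod poly_sum poly_monom)
qed

text \<open>A chord of the unit circle is no longer than its arc.\<close>

lemma norm_one_minus_cis_le: "norm (1 - cis t) \<le> \<bar>t\<bar>"
proof -
  have "norm (1 - cis t) = norm (exp (\<i> * complex_of_real t) - 1)"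
    by (simp add: cis_conv_exp norm_minus_commute)
  also have "\<dots> = 2 * \<bar>sin (t / 2)\<bar>"
    by (rule dist_exp_i_1)
  also have "\<dots> \<le> \<bar>t\<bar>"
    using abs_sin_x_le_abs_x[of "t / 2"] by simp
  finally show ?thesis .
qed

text \<open>Each omitted factor is of order \<open>1 / N\<close>, so dividing three of them out of
  the full product \<open>N\<close> gives quartic growth, against a quadratic upper bound.\<close>

lemma norm_prod_cis_lower_bound:
  fixes m :: nat
  defines "N \<equiv> m + 4"
  shows "real N ^ 4 / (6 * (2 * pi) ^ 3)
      \<le> norm (\<Prod>i=1..m. 1 - cis (2 * pi / real N) ^ i)"
proof -
  let ?f = "\<lambda>k. norm (1 - cis (2 * pi * real k / real N))"
  have le: "?f (N - j) \<le> 2 * pi * real j / real N" if "j \<le> N" for j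
  proof -
    \<comment> \<open>Subtracting a full turn replaces the angle by a small negative one, where the
      arc bound is useful.\<close>
    have "2 * pi * real (N - j) / real N = 2 * pi - 2 * pi * real j / real N"
      using that by (simp add: N_def field_simps)
    then have "cis (2 * pi * real (N - j) / real N) = cis (- (2 * pi * real j / real N))"
      by (simp add: cis.ctr)
    then show ?thesis
      using norm_one_minus_cis_le[of "- (2 * pi * real j / real N)"] by simp
  qed
  have split: "(\<Prod>k=1..<N. g k) = (\<Prod>k=1..m. g k) * (g (N - 3) * g (N - 2) * g (N - 1))"
    for g :: "nat \<Rightarrow> real"
  proof -
    have "{1..<N} = {1..m} \<union> {m + 1, m + 2, m + 3}"
      by (auto simp: N_def)
    then show ?thesis
      by (simp add: prod.union_disjoint N_def add.commute)
  qed
  have "real N = norm (\<Prod>k=1..<N. 1 - cis (2 * pi * real k / real N))"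
    by (subst prod_one_minus_roots_of_unity) (simp_all only: norm_of_nat, simp add: N_def)
  also have "\<dots> = (\<Prod>k=1..<N. ?f k)"
    by (simp add: prod_norm)
  also have "\<dots> = (\<Prod>k=1..m. ?f k) * (?f (N - 3) * ?f (N - 2) * ?f (N - 1))"
    by (rule split)
  also have "\<dots> \<le> (\<Prod>k=1..m. ?f k) *
      ((2 * pi * real 3 / real N) * (2 * pi * real 2 / real N) * (2 * pi * real 1 / real N))"
    by (intro mult_left_mono mult_mono le prod_nonneg mult_nonneg_nonneg) (auto simp: N_def)
  also have "\<dots> = (\<Prod>k=1..m. ?f k) * (6 * (2 * pi) ^ 3) / real N ^ 3"
    by (simp add: power3_eq_cube)
  finally have "real N \<le> (\<Prod>k=1..m. ?f k) * (6 * (2 * pi) ^ 3) / real N ^ 3" .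
  then have "real N ^ 4 \<le> (\<Prod>k=1..m. ?f k) * (6 * (2 * pi) ^ 3)"
    by (simp add: N_def pos_le_divide_eq power4_eq_xxxx power3_eq_cube mult_ac)
  then have "real N ^ 4 / (6 * (2 * pi) ^ 3) \<le> (\<Prod>k=1..m. ?f k)"
    by (simp add: pos_divide_le_eq)
  then show ?thesis
    by (simp add: prod_norm Complex.DeMoivre mult_ac)
qed

lemma not_bloch_polya_qq_large:
  assumes "m \<ge> 20"
  shows "\<not> bloch_polya (qq m)"
proof
  assume "bloch_polya (qq m)"
  then have "real (m + 4) ^ 4 / (6 * (2 * pi) ^ 3) \<le> real (m * (m + 1) div 2) + 1"
    using norm_prod_cis_lower_bound[of m]
      norm_prod_le_if_bloch_polya[of m "cis (2 * pi / real (m + 4))"] by simp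
  \<comment> \<open>The rational bound 6.3 for \<open>2 * pi\<close> gives 6 * 6.3^3 = 1500.282,
    hence the constant 1501.\<close>
  moreover have "(2 * pi) ^ 3 \<le> (63/10) ^ 3"
    using pi_approx(2) by (intro power_mono) auto
  then have "6 * (2 * pi) ^ 3 \<le> 1501"
    by (simp add: power3_eq_cube)
  then have "real (m + 4) ^ 4 / 1501 \<le> real (m + 4) ^ 4 / (6 * (2 * pi) ^ 3)"
    by (intro divide_left_mono) auto
  moreover have "real (m * (m + 1) div 2) = real m * (real m + 1) / 2"
    by (simp add: real_of_nat_div algebra_simps)
  ultimately have "(real m + 4) ^ 4 \<le> 1501 * (real m * (real m + 1) / 2 + 1)"
    by simp
  moreover
  \<comment> \<open>After this shift, left side minus right side is a polynomial in \<open>x\<close>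
    with only positive coefficients.\<close>
  define x where "x = real m - 20"
  have "x \<ge> 0" "real m = x + 20"
    using assms by (auto simp: x_def)
  ultimately show False
    by (simp add: power4_eq_xxxx algebra_simps) (smt (verit) mult_nonneg_nonneg)
qed

theorem theorem1p3:
  fixes m :: nat
  shows "bloch_polya (qq m) \<longleftrightarrow> m \<in> {0, 1, 2, 3, 5}"
proof
  assume bp: "bloch_polya (qq m)"
  then have "\<not> m \<ge> 20" "\<not> (m = 4 \<or> 6 \<le> m \<and> m < 20)"
    using not_bloch_polya_qq_large not_bloch_polya_qq_small by blast+
  then have "m < 6" "m \<noteq> 4" by linarith+
  then show "m \<in> {0, 1, 2, 3, 5}" by auto
qed (rule bloch_polya_qq_small)

end
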